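(* If a connected graph $G$ admits a monotone-geodesic labeling, then $\operatorname{gp}(G)\le 4$.
   Context: A geodesic of a graph is a shortest path. A set $S\subseteq V(G)$ is a general position set of $G$ if no three distinct vertices of $S$ lie on a common geodesic of $G$. The general position number $\operatorname{gp}(G)$ is the maximum cardinality of a general position set of $G$. Graphs may be infinite. A sequence of real numbers is monotone if it is monotonically increasing or monotonically decreasing (in the weak sense, equalities allowed). A sequence $((x_1,y_1),\ldots,(x_k,y_k))$ of points of $\mathbb{R}^2$ is monotone if both sequences $(x_1,\ldots,x_k)$ and $(y_1,\ldots,y_k)$ are monotone (one may be increasing and the other decreasing). An injective map $f:V(G)\to\mathbb{R}^2$ is a monotone-geodesic labeling of $G$ if, whenever $x,y,z$ are vertices of $G$ such that the sequence $(f(x),f(y),f(z))$ is monotone, the vertices $x,y,z$ lie on a common geodesic of $G$. *)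

theory Defs
  imports "Graph_Theory.Graph_Theory" "HOL-Library.Extended_Nat" Complex_Main
begin

text \<open>
  Simple graphs are modelled, as in the library, by symmetric digraphs without loops and
  parallel arcs; unlike in the library locale \<open>graph\<close>, neither vertices nor arcs need be finite.
\<close>

locale simple_graph = loopfree_digraph + nomulti_digraph + sym_digraph

definition geodesic :: "('a, 'b) pre_digraph \<Rightarrow> 'a list \<Rightarrow> bool" where
  "geodesic G p \<longleftrightarrow> vpath p G \<and>
     (\<forall>q. vpath q G \<and> hd q = hd p \<and> last q = last p \<longrightarrow> vwalk_length p \<le> vwalk_length q)"

definition on_common_geodesic :: "('a, 'b) pre_digraph \<Rightarrow> 'a set \<Rightarrow> bool" where
  "on_common_geodesic G X \<longleftrightarrow> (\<exists>p. geodesic G p \<and> X \<subseteq> set p)"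

definition general_position :: "('a, 'b) pre_digraph \<Rightarrow> 'a set \<Rightarrow> bool" where
  "general_position G S \<longleftrightarrow> S \<subseteq> verts G \<and>
     (\<forall>x\<in>S. \<forall>y\<in>S. \<forall>z\<in>S. distinct [x, y, z] \<longrightarrow> \<not> on_common_geodesic G {x, y, z})"

definition ecard :: "'a set \<Rightarrow> enat" where
  "ecard S = (if finite S then enat (card S) else \<infinity>)"

text \<open>
  The maximum is taken as a supremum in \<open>enat\<close>, so that it also makes sense for infinite graphs:
  it is attained whenever it is finite, and it is \<open>\<infinity>\<close> if general position sets can be
  infinite or arbitrarily large.
\<close>

definition gp :: "('a, 'b) pre_digraph \<Rightarrow> enat" where
  "gp G = (SUP S\<in>{S. general_position G S}. ecard S)"

definition monotone_seq :: "real list \<Rightarrow> bool" where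
  "monotone_seq xs \<longleftrightarrow> sorted_wrt (\<le>) xs \<or> sorted_wrt (\<ge>) xs"

definition monotone_points :: "(real \<times> real) list \<Rightarrow> bool" where
  "monotone_points ps \<longleftrightarrow> monotone_seq (map fst ps) \<and> monotone_seq (map snd ps)"

definition monotone_geodesic_labeling ::
  "('a, 'b) pre_digraph \<Rightarrow> ('a \<Rightarrow> real \<times> real) \<Rightarrow> bool" where
  "monotone_geodesic_labeling G f \<longleftrightarrow> inj_on f (verts G) \<and>
     (\<forall>x\<in>verts G. \<forall>y\<in>verts G. \<forall>z\<in>verts G.
        monotone_points [f x, f y, f z] \<longrightarrow> on_common_geodesic G {x, y, z})"

end

theory Submission
  imports Defs
begin

text \<open>
  The bound is the Erdos--Szekeres theorem for five points. List any five distinct vertices by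
  increasing first coordinate of their labels. Among the five second coordinates, some three
  form a monotone sequence, and the three vertices concerned then have a monotone sequence of
  labels: their first coordinates are increasing because of the chosen order. The labeling puts
  these vertices on a common geodesic, so no five vertices are in general position.
\<close>

text \<open>
  Let the numbers be \<open>a, b, c, d, e\<close>, so that \<open>a \<le> b\<close>. A later number that is at least \<open>b\<close>
  completes \<open>a, b\<close> to an increasing triple. Otherwise \<open>c, d, e\<close> all lie below \<open>b\<close>; then a
  descent from \<open>c\<close> to \<open>d\<close> or from \<open>d\<close> to \<open>e\<close> forms a decreasing triple with \<open>b\<close>, and without
  such a descent \<open>c, d, e\<close> is itself increasing.
\<close>

lemma monotone_triple_of_five_if_ascent:
  fixes ys :: "real list"
  assumes ascent: "ys ! 0 \<le> ys ! 1"
  shows "\<exists>i j k. i < j \<and> j < k \<and> k < 5 \<and> monotone_seq [ys ! i, ys ! j, ys ! k]"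
proof -
  have triple: ?thesis
    if "j < k" "k < 5" "monotone_seq [ys ! i, ys ! j, ys ! k]" "i < j" for i j k
    using that by blast
  consider k where "k \<in> {2, 3, 4}" "ys ! 1 \<le> ys ! k"
    | "ys ! 2 < ys ! 1" "ys ! 3 < ys ! 1" "ys ! 4 < ys ! 1"
    by force
  then show ?thesis
  proof cases
    case (1 k)
    then show ?thesis
      using ascent by (intro triple[of 1 k 0]) (auto simp: monotone_seq_def)
  next
    case 2
    consider "ys ! 3 \<le> ys ! 2" | "ys ! 4 \<le> ys ! 3" | "ys ! 2 \<le> ys ! 3" "ys ! 3 \<le> ys ! 4"
      by linarith
    then show ?thesis
    proof cases
      case 1
      then show ?thesis
        using 2 by (intro triple[of 2 3 1]) (auto simp: monotone_seq_def)
    next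
      case d: 2
      then show ?thesis
        using 2 by (intro triple[of 3 4 1]) (auto simp: monotone_seq_def)
    next
      case 3
      then show ?thesis
        by (intro triple[of 3 4 2]) (auto simp: monotone_seq_def)
    qed
  qed
qed

lemma monotone_triple_of_five:
  fixes ys :: "real list"
  assumes len: "length ys = 5"
  shows "\<exists>i j k. i < j \<and> j < k \<and> k < 5 \<and> monotone_seq [ys ! i, ys ! j, ys ! k]"
proof (cases "ys ! 0 \<le> ys ! 1")
  case True
  then show ?thesis
    by (rule monotone_triple_of_five_if_ascent)
next
  case False
  \<comment> \<open>Negation exchanges increasing and decreasing sequences.\<close>
  with len have "map uminus ys ! 0 \<le> map uminus ys ! 1"
    by simp
  with len obtain i j k where ijk: "i < j" "j < k" "k < 5"
    and "monotone_seq [map uminus ys ! i, map uminus ys ! j, map uminus ys ! k]"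
    using monotone_triple_of_five_if_ascent[of "map uminus ys"] by auto
  with len have "monotone_seq [ys ! i, ys ! j, ys ! k]"
    by (auto simp: monotone_seq_def)
  with ijk show ?thesis
    by blast
qed

lemma monotone_points_triple_of_five:
  fixes f :: "'a \<Rightarrow> real \<times> real"
  assumes "card T = 5"
  obtains x y z where "{x, y, z} \<subseteq> T" "distinct [x, y, z]" "monotone_points [f x, f y, f z]"
proof -
  have "finite T"
    using assms by (intro card_ge_0_finite) simp
  then obtain us where us: "set us = T" "distinct us"
    using finite_distinct_list by blast
  define xs where "xs = sort_key (fst \<circ> f) us"
  have xs: "set xs = T" "distinct xs" "sorted (map (fst \<circ> f) xs)"
    using us by (simp_all add: xs_def)
  then have len: "length xs = 5"
    using assms distinct_card by metis
  then obtain i j k where ijk: "i < j" "j < k" "k < 5"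
    and mono: "monotone_seq [map (snd \<circ> f) xs ! i, map (snd \<circ> f) xs ! j, map (snd \<circ> f) xs ! k]"
    using monotone_triple_of_five[of "map (snd \<circ> f) xs"] by auto
  have le: "fst (f (xs ! m)) \<le> fst (f (xs ! n))" if "m < n" "n < 5" for m n
    using sorted_nth_mono[OF xs(3), of m n] that len by simp
  show thesis
  proof
    show "{xs ! i, xs ! j, xs ! k} \<subseteq> T"
      using ijk len xs(1) by auto
    show "distinct [xs ! i, xs ! j, xs ! k]"
      using ijk len xs(2) by (auto simp: nth_eq_iff_index_eq)
    show "monotone_points [f (xs ! i), f (xs ! j), f (xs ! k)]"
      using mono le ijk len by (auto simp: monotone_points_def monotone_seq_def)
  qed
qed

lemma no_five_in_general_position:
  assumes lab: "monotone_geodesic_labeling G f"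
    and gen: "general_position G S"
    and T: "T \<subseteq> S"
  shows "card T \<noteq> 5"
proof
  assume "card T = 5"
  then obtain x y z where xyz: "{x, y, z} \<subseteq> T" "distinct [x, y, z]"
    and mono: "monotone_points [f x, f y, f z]"
    by (rule monotone_points_triple_of_five)
  have "{x, y, z} \<subseteq> S" "{x, y, z} \<subseteq> verts G"
    using xyz(1) T gen by (auto simp: general_position_def)
  moreover from this have "on_common_geodesic G {x, y, z}"
    using lab mono by (simp add: monotone_geodesic_labeling_def)
  ultimately show False
    using gen xyz(2) by (simp add: general_position_def)
qed

lemma ecard_le_if_no_larger_subset:
  assumes "\<And>T. T \<subseteq> S \<Longrightarrow> card T \<noteq> Suc n"
  shows "ecard S \<le> enat n"
proof -
  have "finite S"
    using assms infinite_arbitrarily_large by blast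
  moreover have "card S \<le> n"
    using assms obtain_subset_with_card_n[of "Suc n" S] by (metis not_less_eq_eq)
  ultimately show ?thesis
    by (simp add: ecard_def)
qed

theorem lemma2p6:
  fixes G :: "('a, 'b) pre_digraph"
  assumes "simple_graph G"
    and "Digraph_Component.connected G"
    and "\<exists>f. monotone_geodesic_labeling G f"
  shows "gp G \<le> 4"
proof -
  obtain f where lab: "monotone_geodesic_labeling G f"
    using assms(3) by blast
  have "ecard S \<le> 4" if "general_position G S" for S
    using ecard_le_if_no_larger_subset[of S 4] no_five_in_general_position[OF lab that]
    by (simp add: numeral_eq_enat)
  then show ?thesis
    unfolding gp_def by (intro SUP_least) simp
qed

end
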